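(* Let $a,b$ be non-zero complex numbers with $|a|^2+|b|^2=1$. Suppose that an orthonormal basis of $\mathbb{C}^2\otimes\mathbb{C}^2$ consisting of two product states and two entangled states contains the product states $|00\rangle_{AB}$ and $|11\rangle_{AB}$ and the entangled state with Schmidt decomposition $$|\mathrm{ppEe}\rangle_{AB}=|a|\left(\frac{a}{|a|}|01\rangle_{AB}\right)+|b|\left(\frac{b}{|b|}|10\rangle_{AB}\right).$$ Then, up to a global phase, the other entangled state of the basis has the Schmidt decomposition $$|\mathrm{ppeE}\rangle_{AB}=|b|\left(\frac{b^*}{|b|}|01\rangle_{AB}\right)+|a|\left(\frac{-a^*}{|a|}|10\rangle_{AB}\right).$$
   Context: $|0\rangle,|1\rangle$ is the standard basis of $\mathbb{C}^2$, $|jk\rangle_{AB}=|j\rangle_A\otimes|k\rangle_B$, and $^*$ is complex conjugation. A state is a unit vector; a state in $\mathbb{C}^2\otimes\mathbb{C}^2$ is a product state if it equals $|u\rangle\otimes|v\rangle$, and entangled otherwise. A Schmidt decomposition of a state is an expression $\sum_j\lambda_j|u_j\rangle\otimes|v_j\rangle$ with $\lambda_j\ge 0$ and $\{|u_j\rangle\}$, $\{|v_j\rangle\}$ orthonormal families in $\mathbb{C}^2$ (phases may be absorbed into either tensor factor). A global phase is a complex number of modulus one multiplying the state. *)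

theory Defs
  imports "HOL-Analysis.Analysis"
begin

type_synonym qubit = "complex ^ 2"

text \<open>The coordinate of \<open>complex ^ (2 \<times> 2)\<close> at \<open>(j, k)\<close> is the coefficient of \<open>|jk\<rangle>\<close>.\<close>

type_synonym two_qubit = "complex ^ (2 \<times> 2)"

definition tensor :: "qubit \<Rightarrow> qubit \<Rightarrow> two_qubit" (infixl \<open>\<otimes>\<close> 75) where
  "u \<otimes> v = (\<chi> p. u $ fst p * v $ snd p)"

definition ket :: "2 \<Rightarrow> qubit" where
  "ket j = axis j 1"

definition ket2 :: "2 \<Rightarrow> 2 \<Rightarrow> two_qubit" where
  "ket2 j k = ket j \<otimes> ket k"

text \<open>The library's \<open>inner\<close> on \<open>complex ^ 'n\<close> is real-valued (the real part of the
  form below), so the Hermitian form is defined here; it is antilinear in the first argument.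
  The library's \<open>norm\<close> is the norm induced by either of them.\<close>

definition hinner :: "complex ^ 'n \<Rightarrow> complex ^ 'n \<Rightarrow> complex" where
  "hinner x y = (\<Sum>i\<in>UNIV. cnj (x $ i) * y $ i)"

definition is_state :: "complex ^ 'n \<Rightarrow> bool" where
  "is_state \<psi> \<longleftrightarrow> norm \<psi> = 1"

definition product_state :: "two_qubit \<Rightarrow> bool" where
  "product_state \<psi> \<longleftrightarrow> is_state \<psi> \<and> (\<exists>u v. \<psi> = u \<otimes> v)"

definition entangled_state :: "two_qubit \<Rightarrow> bool" where
  "entangled_state \<psi> \<longleftrightarrow> is_state \<psi> \<and> \<not> product_state \<psi>"

definition orthonormal_family :: "nat \<Rightarrow> (nat \<Rightarrow> complex ^ 'n) \<Rightarrow> bool" where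
  "orthonormal_family n u \<longleftrightarrow>
     (\<forall>i<n. \<forall>j<n. hinner (u i) (u j) = (if i = j then 1 else 0))"

text \<open>The span is the complex one: \<open>vec.span\<close> uses scalar multiplication \<open>(*s)\<close>.\<close>

definition orthonormal_basis :: "(complex ^ 'n) set \<Rightarrow> bool" where
  "orthonormal_basis B \<longleftrightarrow>
     (\<forall>x\<in>B. \<forall>y\<in>B. hinner x y = (if x = y then 1 else 0)) \<and> vec.span B = UNIV"

text \<open>An expression \<open>\<Sum>\<^sub>j \<lambda>\<^sub>j w\<^sub>j\<close> is given as the list of pairs \<open>(\<lambda>\<^sub>j, w\<^sub>j)\<close>.
  Each \<open>w\<^sub>j\<close> is a vector of the tensor product rather than a pair of
  factors, so that a phase in front of \<open>|jk\<rangle>\<close> may be absorbed into either factor.\<close>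

definition schmidt_decomposition :: "two_qubit \<Rightarrow> (real \<times> two_qubit) list \<Rightarrow> bool" where
  "schmidt_decomposition \<psi> ts \<longleftrightarrow>
     \<psi> = (\<Sum>j<length ts. complex_of_real (fst (ts ! j)) *s snd (ts ! j)) \<and>
     (\<forall>j<length ts. 0 \<le> fst (ts ! j)) \<and>
     (\<exists>u v. orthonormal_family (length ts) u \<and> orthonormal_family (length ts) v \<and>
        (\<forall>j<length ts. snd (ts ! j) = u j \<otimes> v j))"

end

theory Submission imports Defs begin

text \<open>Orthogonality to \<open>|00\<rangle>\<close> and \<open>|11\<rangle>\<close> forces the other state into the span of \<open>|01\<rangle>\<close> and
  \<open>|10\<rangle>\<close>; there orthogonality to \<open>a|01\<rangle> + b|10\<rangle>\<close> leaves only the line through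
  \<open>b\<^sup>*|01\<rangle> - a\<^sup>*|10\<rangle>\<close>, and normalization leaves only a phase.\<close>

text \<open>Arithmetic in the type \<open>2\<close> is modulo 2, so the numeral \<open>2\<close> is
  \<open>0\<close>, and the qubit labels can be taken as \<open>0\<close> and
  \<open>1\<close>.\<close>

lemma UNIV_two: "(UNIV :: 2 set) = {0, 1}"
proof -
  have "(2 :: 2) = 0" by simp
  then show ?thesis using UNIV_2 by (metis insert_commute)
qed

lemma sum_UNIV_two: "(\<Sum>i\<in>UNIV. f (i :: 2)) = f 0 + f 1"
  by (simp add: UNIV_two)

lemma all_two: "(\<forall>i :: 2. P i) \<longleftrightarrow> P 0 \<and> P 1"
proof -
  have "(\<forall>i :: 2. P i) \<longleftrightarrow> (\<forall>i \<in> {0, 1}. P i)"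
    unfolding UNIV_two[symmetric] by simp
  then show ?thesis by simp
qed

lemma hinner_two_qubit:
  "hinner (\<phi> :: two_qubit) \<psi> =
     cnj (\<phi> $ (0, 0)) * \<psi> $ (0, 0) + cnj (\<phi> $ (0, 1)) * \<psi> $ (0, 1)
     + cnj (\<phi> $ (1, 0)) * \<psi> $ (1, 0) + cnj (\<phi> $ (1, 1)) * \<psi> $ (1, 1)"
proof -
  have "hinner \<phi> \<psi> = (\<Sum>i\<in>UNIV. \<Sum>j\<in>UNIV. cnj (\<phi> $ (i, j)) * \<psi> $ (i, j))"
    unfolding hinner_def sum.cartesian_product UNIV_Times_UNIV by (simp add: case_prod_unfold)
  then show ?thesis by (simp add: sum_UNIV_two add.assoc)
qed

lemma ket2_nth: "ket2 j k $ p = (if p = (j, k) then 1 else 0)"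
  by (cases p) (auto simp: ket2_def ket_def tensor_def axis_def)

text \<open>Turns orthogonality to a basis ket into the vanishing of a coordinate.\<close>

lemma hinner_ket2: "hinner (ket2 j k) \<psi> = \<psi> $ (j, k)"
proof -
  have "hinner (ket2 j k) \<psi> = (\<Sum>p\<in>UNIV. if p = (j, k) then \<psi> $ p else 0)"
    unfolding hinner_def by (rule sum.cong) (auto simp: ket2_nth)
  then show ?thesis by simp
qed

lemma two_qubit_eqI:
  fixes \<phi> \<psi> :: two_qubit
  assumes "\<phi> $ (0, 0) = \<psi> $ (0, 0)" "\<phi> $ (0, 1) = \<psi> $ (0, 1)"
    "\<phi> $ (1, 0) = \<psi> $ (1, 0)" "\<phi> $ (1, 1) = \<psi> $ (1, 1)"
  shows "\<phi> = \<psi>"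
  unfolding vec_eq_iff split_paired_All all_two using assms by simp

lemma ket_nth: "ket j $ i = (if i = j then 1 else 0)"
  by (auto simp: ket_def axis_def)

lemma hinner_qubit:
  "hinner (u :: qubit) v = cnj (u $ 0) * v $ 0 + cnj (u $ 1) * v $ 1"
  by (simp add: hinner_def sum_UNIV_two)

lemma product_state_ket2: "product_state (ket2 j k)"
proof -
  have "ket2 j k = axis (j, k) 1"
    unfolding vec_eq_iff ket2_nth by (auto simp: axis_def)
  then have "norm (ket2 j k) = 1" by (simp add: norm_axis_1)
  then show ?thesis unfolding product_state_def is_state_def ket2_def by blast
qed

text \<open>Each coefficient is split into modulus and phase; the moduli are the Schmidt
  coefficients and the phases are absorbed into the kets.\<close>

lemma schmidt_decomposition_01_10:
  assumes "r \<ge> 0" "s \<ge> 0" "cmod z = 1" "cmod w = 1"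
    and "\<psi> = (of_real r * z) *s ket2 0 1 + (of_real s * w) *s ket2 1 0"
  shows "schmidt_decomposition \<psi> [(r, z *s ket2 0 1), (s, w *s ket2 1 0)]"
proof -
  \<comment> \<open>Both phases go into the first factor, where modulus one keeps the family
    orthonormal; the second factor carries the bare kets in swapped order.\<close>
  define u :: "nat \<Rightarrow> qubit" where "u = (\<lambda>j. if j = 0 then z *s ket 0 else w *s ket 1)"
  define v :: "nat \<Rightarrow> qubit" where "v = (\<lambda>j. if j = 0 then ket 1 else ket 0)"
  have phase: "cnj z * z = 1" "cnj w * w = 1"
    using assms(3,4) by (simp_all add: complex_norm_square[symmetric] mult.commute[of "cnj _"])
  have "orthonormal_family 2 u" "orthonormal_family 2 v"
    using phase by (auto simp: orthonormal_family_def u_def v_def hinner_qubit ket_nth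
        less_2_cases_iff)
  moreover have "z *s ket2 0 1 = u 0 \<otimes> v 0" "w *s ket2 1 0 = u 1 \<otimes> v 1"
    by (simp_all add: u_def v_def ket2_def tensor_def vec_eq_iff)
  ultimately have "\<exists>u v. orthonormal_family 2 u \<and> orthonormal_family 2 v \<and>
      (\<forall>j<2. snd ([(r, z *s ket2 0 1), (s, w *s ket2 1 0)] ! j) = u j \<otimes> v j)"
    by (intro exI[of _ u] exI[of _ v]) (simp add: less_2_cases_iff all_conj_distrib)
  then show ?thesis
    unfolding schmidt_decomposition_def using assms(1,2,5)
    by (simp add: numeral_2_eq_2 less_Suc_eq lessThan_Suc add.commute)
qed

theorem theorem15:
  fixes a b :: complex and B :: "two_qubit set" and ppEe other :: two_qubit
  assumes "a \<noteq> 0" and "b \<noteq> 0" and "(cmod a)\<^sup>2 + (cmod b)\<^sup>2 = 1"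
    and "orthonormal_basis B"
    and "card {\<psi> \<in> B. product_state \<psi>} = 2"
    and "card {\<psi> \<in> B. entangled_state \<psi>} = 2"
    and "ket2 0 0 \<in> B" and "ket2 1 1 \<in> B"
    and "ppEe \<in> B" and "entangled_state ppEe"
    and "schmidt_decomposition ppEe
           [(cmod a, (a / cmod a) *s ket2 0 1), (cmod b, (b / cmod b) *s ket2 1 0)]"
    and "other \<in> B" and "entangled_state other" and "other \<noteq> ppEe"
  shows "\<exists>c. cmod c = 1 \<and>
           schmidt_decomposition (c *s other)
             [(cmod b, (cnj b / cmod b) *s ket2 0 1), (cmod a, (- cnj a / cmod a) *s ket2 1 0)]"
proof -
  have ip: "hinner x y = (if x = y then 1 else 0)" if "x \<in> B" "y \<in> B" for x y
    using assms(4) that by (auto simp: orthonormal_basis_def)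
  \<comment> \<open>An entangled state is no basis ket, so \<open>other\<close> is orthogonal to the
    members |00> and |11> of \<open>B\<close>.\<close>
  have "other \<noteq> ket2 j k" for j k
    using assms(13) product_state_ket2 by (auto simp: entangled_state_def)
  then have zero: "other $ (0, 0) = 0" "other $ (1, 1) = 0"
    using ip[OF assms(7,12)] ip[OF assms(8,12)] by (auto simp: hinner_ket2)
  define p q where "p = other $ (0, 1)" and "q = other $ (1, 0)"
  \<comment> \<open>The moduli cancel against the denominators of the phases, as \<open>a\<close>
    and \<open>b\<close> are non-zero.\<close>
  have "ppEe = a *s ket2 0 1 + b *s ket2 1 0"
    using assms(1,2,11)
    by (simp add: schmidt_decomposition_def lessThan_Suc vec.scale_scale add.commute)
  then have "ppEe $ (0, 1) = a" "ppEe $ (1, 0) = b" "ppEe $ (0, 0) = 0" "ppEe $ (1, 1) = 0"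
    by (simp_all add: ket2_nth)
  then have orth: "cnj a * p + cnj b * q = 0"
    using ip[OF assms(9,12)] assms(14) by (simp add: hinner_two_qubit p_def q_def)
  have "cnj p * p + cnj q * q = 1"
    using ip[OF assms(12,12)] zero by (simp add: hinner_two_qubit p_def q_def)
  \<comment> \<open>Normalization came as an equation between complex numbers; injectivity of the
    embedding of the reals makes it one between squared moduli.\<close>
  then have "complex_of_real ((cmod p)\<^sup>2 + (cmod q)\<^sup>2) = of_real 1"
    by (simp only: of_real_add complex_norm_square mult.commute[of "cnj _"] of_real_1)
  then have unit: "(cmod p)\<^sup>2 + (cmod q)\<^sup>2 = 1"
    by (simp only: of_real_eq_iff)
  \<comment> \<open>The solutions \<open>(p, q)\<close> of \<open>orth\<close> are the multiples of
    \<open>(cnj b, - cnj a)\<close>; the first coordinate fixes the factor \<open>t\<close>.\<close>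
  define t where "t = p / cnj b"
  have p: "p = t * cnj b" using assms(2) by (simp add: t_def)
  have "cnj b * (q + t * cnj a) = 0" using orth p by (simp add: algebra_simps)
  then have q: "q = - t * cnj a"
    using assms(2) by (simp add: eq_neg_iff_add_eq_0)
  \<comment> \<open>The vector \<open>(cnj b, - cnj a)\<close> has norm one like
    \<open>(p, q)\<close>, so \<open>t\<close> must be a phase.\<close>
  have "(cmod t)\<^sup>2 * ((cmod a)\<^sup>2 + (cmod b)\<^sup>2) = 1"
    using unit by (simp add: p q norm_mult power_mult_distrib algebra_simps)
  then have t: "cmod t = 1" using assms(3) by (simp add: abs_square_eq_1)
  then have tt: "cnj t * t = 1"
    by (simp add: complex_norm_square[symmetric] mult.commute[of "cnj _"])
  \<comment> \<open>Since \<open>t\<close> has modulus one, \<open>cnj t\<close> is its inverse; it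
    is the global phase that brings \<open>other\<close> into the claimed form.\<close>
  have "cnj t * p = cnj b" "cnj t * q = - cnj a"
    using tt by (simp_all add: p q mult.assoc[symmetric])
  then have "cnj t *s other = cnj b *s ket2 0 1 + (- cnj a) *s ket2 1 0"
    by (intro two_qubit_eqI) (simp_all add: ket2_nth zero p_def q_def)
  then have "schmidt_decomposition (cnj t *s other)
      [(cmod b, (cnj b / cmod b) *s ket2 0 1), (cmod a, (- cnj a / cmod a) *s ket2 1 0)]"
    using assms(1,2) by (intro schmidt_decomposition_01_10) (simp_all add: norm_divide)
  then show ?thesis using t by (intro exI[of _ "cnj t"]) simp
qed

end
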